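(* Let $n\ge 2$, let $O$ be an interior point of a smooth closed convex set $\mathcal D\subset\mathbb R^n$, and let the segment $[A^*B^*]$ (with $O\in[A^*B^*]$ and $A^*,B^*\in\partial\mathcal D$) be a local maximizer for $F$. Let $\Pi_1$ and $\Pi_2$ be the only supporting hyperplanes of $\mathcal D$ at $A^*$ and $B^*$, respectively. Then the normal line to $\Pi_1$ at $A^*$ and the normal line to $\Pi_2$ at $B^*$ intersect at a point belonging to the hyperplane through $O$ which is orthogonal to the line $A^*B^*$.
   Context: $\partial\mathcal D$ is the boundary of $\mathcal D$; $|AB|$ is the Euclidean length of the segment $[AB]$. For a closed convex set $\mathcal D$ with interior point $O$, consider all segments $[AB]$ containing $O$ with end-points $A,B\in\partial\mathcal D$, and put $F([AB])=|AB|$. A segment $[A^*B^*]$ containing $O$, with end-points on $\partial\mathcal D$, is a local maximizer for $F$ if there are open sets $U\ni A^*$ and $V\ni B^*$ such that $|AB|\le|A^*B^*|$ whenever $O\in[AB]$, $A\in\partial\mathcal D\cap U$ and $B\in\partial\mathcal D\cap V$. A hyperplane $\Pi$ supports $\mathcal D$ at $A\in\mathcal D$ if $A\in\Pi$ and $\mathcal D$ is contained in one of the two closed half-spaces determined by $\Pi$. A convex set with nonempty interior is smooth if there is only one supporting hyperplane at every point of its boundary. "The normal lines intersect at a point belonging to a hyperplane" means that there is a point common to both normal lines and the hyperplane (the two normal lines are allowed to coincide). *)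

theory Defs
  imports "HOL-Analysis.Analysis"
begin

definition supporting_hyperplane :: "'a::euclidean_space set \<Rightarrow> 'a \<Rightarrow> 'a set \<Rightarrow> bool" where
  "supporting_hyperplane D A H \<longleftrightarrow>
     A \<in> D \<and> A \<in> H \<and>
     (\<exists>a b. a \<noteq> 0 \<and> H = {x. a \<bullet> x = b} \<and>
        (D \<subseteq> {x. a \<bullet> x \<le> b} \<or> D \<subseteq> {x. a \<bullet> x \<ge> b}))"

definition smooth_convex :: "'a::euclidean_space set \<Rightarrow> bool" where
  "smooth_convex D \<longleftrightarrow>
     convex D \<and> interior D \<noteq> {} \<and> (\<forall>A \<in> frontier D. \<exists>!H. supporting_hyperplane D A H)"

definition local_maximizer :: "'a::euclidean_space set \<Rightarrow> 'a \<Rightarrow> 'a \<Rightarrow> 'a \<Rightarrow> bool" where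
  "local_maximizer D p A B \<longleftrightarrow>
     A \<in> frontier D \<and> B \<in> frontier D \<and> p \<in> closed_segment A B \<and>
     (\<exists>U V. open U \<and> A \<in> U \<and> open V \<and> B \<in> V \<and>
        (\<forall>A' \<in> frontier D \<inter> U. \<forall>B' \<in> frontier D \<inter> V.
           p \<in> closed_segment A' B' \<longrightarrow> dist A' B' \<le> dist A B))"

text \<open>The line through \<open>A\<close> perpendicular to \<open>H\<close>: the points \<open>x\<close> such that \<open>x - A\<close> is orthogonal
  to every direction \<open>y - z\<close> of \<open>H\<close>. This is a line only when \<open>H\<close> is a hyperplane.\<close>

definition normal_line :: "'a::euclidean_space set \<Rightarrow> 'a \<Rightarrow> 'a set" where
  "normal_line H A = {x. \<forall>y \<in> H. \<forall>z \<in> H. orthogonal (x - A) (y - z)}"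

text \<open>The hyperplane through \<open>p\<close> orthogonal to the line \<open>A B\<close>, for \<open>A \<noteq> B\<close>.\<close>

definition orthogonal_hyperplane :: "'a::euclidean_space \<Rightarrow> 'a \<Rightarrow> 'a \<Rightarrow> 'a set" where
  "orthogonal_hyperplane p A B = {x. orthogonal (x - p) (B - A)}"

end

theory Submission
  imports Defs
begin

text \<open>
  Write \<open>v = A - p\<close> and \<open>B - p = - k v\<close>, and let \<open>n\<^sub>1\<close>, \<open>n\<^sub>2\<close> be outer normals at \<open>A\<close>, \<open>B\<close>.
  For \<open>w\<close> orthogonal to \<open>v\<close>, turn the chord into the direction \<open>v + \<tau> w\<close>. By smoothness its
  end-points are \<open>p + s (v + \<tau> w)\<close> and \<open>p - k s' (v + \<tau> w)\<close> with \<open>s = 1 - \<tau> (n\<^sub>1 \<bullet> w) / (n\<^sub>1 \<bullet> v) + o(\<tau>)\<close>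
  and \<open>s' = 1 - \<tau> (n\<^sub>2 \<bullet> w) / (n\<^sub>2 \<bullet> v) + o(\<tau>)\<close>, while the norm of \<open>v + \<tau> w\<close> is at least that of \<open>v\<close>.
  Local maximality therefore forces \<open>n\<^sub>1 / (n\<^sub>1 \<bullet> v) + k n\<^sub>2 / (n\<^sub>2 \<bullet> v)\<close> to be orthogonal to every such
  \<open>w\<close>, hence to be parallel to \<open>v\<close>, and this says that the two normal lines meet the hyperplane
  in the same point.
\<close>

section \<open>Supporting half-spaces and outer normals\<close>

lemma inner_less_of_mem_interior:
  fixes D :: "'a::euclidean_space set"
  assumes "p \<in> interior D" "n \<noteq> 0" "D \<subseteq> {x. n \<bullet> x \<le> b}"
  shows "n \<bullet> p < b"
proof -
  have "interior D \<subseteq> interior {x. n \<bullet> x \<le> b}"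
    using assms(3) by (rule interior_mono)
  then show ?thesis
    using assms(1,2) by (auto simp: interior_halfspace_le)
qed

lemma supporting_hyperplane_normalE:
  fixes D :: "'a::euclidean_space set"
  assumes "supporting_hyperplane D A H"
  obtains n where "n \<noteq> 0" "H = {x. n \<bullet> x = n \<bullet> A}" "D \<subseteq> {x. n \<bullet> x \<le> n \<bullet> A}"
proof -
  obtain a b where ab: "A \<in> H" "a \<noteq> 0" "H = {x. a \<bullet> x = b}"
      "D \<subseteq> {x. a \<bullet> x \<le> b} \<or> D \<subseteq> {x. a \<bullet> x \<ge> b}"
    using assms unfolding supporting_hyperplane_def by auto
  then have b: "b = a \<bullet> A" by simp
  from ab(4) show thesis
  proof
    assume "D \<subseteq> {x. a \<bullet> x \<le> b}"
    then show thesis using that[of a] ab b by simp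
  next
    assume "D \<subseteq> {x. a \<bullet> x \<ge> b}"
    then show thesis using that[of "- a"] ab b by simp
  qed
qed

section \<open>The boundary near a point of smoothness\<close>

text \<open>A ray from \<open>A\<close> that misses the interior can be separated from it by a
  hyperplane, which then supports \<open>D\<close> at \<open>A\<close>. Smoothness identifies this
  hyperplane with the one normal to \<open>n\<close>, but \<open>z\<close> points strictly to its
  inner side. Once a single point of the ray is interior, convexity gives all the nearer
  ones.\<close>

lemma smooth_convex_inward_direction:
  fixes D :: "'a::euclidean_space set"
  assumes sm: "smooth_convex D" and AD: "A \<in> D" and Af: "A \<in> frontier D" and p: "p \<in> interior D"
    and n: "n \<noteq> 0" and Dn: "D \<subseteq> {x. n \<bullet> x \<le> n \<bullet> A}" and z: "n \<bullet> z < 0"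
  shows "\<exists>e>0. \<forall>t. 0 < t \<and> t < e \<longrightarrow> A + t *\<^sub>R z \<in> interior D"
proof -
  have cv: "convex D" using sm by (simp add: smooth_convex_def)
  have "\<exists>e>0. A + e *\<^sub>R z \<in> interior D"
  proof (rule ccontr)
    assume none: "\<not> ?thesis"
    define R where "R = (\<lambda>t. A + t *\<^sub>R z) ` {0..}"
    have AR: "A \<in> R" unfolding R_def by (rule image_eqI[where x=0]) auto
    have zR: "A + z \<in> R" unfolding R_def by (rule image_eqI[where x=1]) auto
    have "A \<notin> interior D" using Af by (simp add: frontier_def)
    then have disj: "interior D \<inter> R = {}"
      using none unfolding R_def by (force simp: order_le_less)
    have cR: "convex R"
    proof -
      have "R = (+) A ` ((\<lambda>t. t *\<^sub>R z) ` {0..})" unfolding R_def by auto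
      moreover have "convex ((\<lambda>t. t *\<^sub>R z) ` {0..})"
        by (intro convex_linear_image linearI) (auto simp: scaleR_add_left)
      ultimately show ?thesis by (simp add: convex_translation)
    qed
    obtain m k where m: "m \<noteq> 0" "\<forall>x\<in>interior D. m \<bullet> x \<le> k" "\<forall>x\<in>R. k \<le> m \<bullet> x"
      using separating_hyperplane_sets[of "interior D" R] cv cR disj AR p convex_interior by blast
    have "closure (interior D) \<subseteq> {x. m \<bullet> x \<le> k}"
      using m(2) by (intro closure_minimal closed_halfspace_le) auto
    moreover have "D \<subseteq> closure (interior D)"
      using convex_closure_interior[OF cv] p closure_subset by blast
    ultimately have Dm: "D \<subseteq> {x. m \<bullet> x \<le> k}" by blast
    \<comment> \<open>\<open>A\<close> lies both in \<open>D\<close> and on the ray, so the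
      separating inequalities meet there.\<close>
    then have k: "k = m \<bullet> A" using m(3) AR AD by force
    have mz: "m \<bullet> z \<ge> 0" using m(3) zR k by (force simp: inner_add_right)
    have mp: "m \<bullet> (p - A) < 0" and np: "n \<bullet> (p - A) < 0"
      using inner_less_of_mem_interior[OF p m(1) Dm] inner_less_of_mem_interior[OF p n Dn] k
      by (simp_all add: inner_diff_right)
    have "supporting_hyperplane D A {x. m \<bullet> x = m \<bullet> A}" "supporting_hyperplane D A {x. n \<bullet> x = n \<bullet> A}"
      using AD m(1) n Dm Dn k unfolding supporting_hyperplane_def by blast+
    then have eq: "{x. m \<bullet> x = m \<bullet> A} = {x. n \<bullet> x = n \<bullet> A}"
      using sm Af unfolding smooth_convex_def by blast
    \<comment> \<open>a point of the first hyperplane lying on the strictly negative side of the second one\<close>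
    define y where "y = A + (m \<bullet> z) *\<^sub>R (p - A) - (m \<bullet> (p - A)) *\<^sub>R z"
    have "m \<bullet> y = m \<bullet> A"
      by (simp add: y_def inner_add_right inner_diff_right)
    then have "n \<bullet> y = n \<bullet> A" using eq by auto
    then have "(m \<bullet> z) * (n \<bullet> (p - A)) = (m \<bullet> (p - A)) * (n \<bullet> z)"
      by (simp add: y_def inner_add_right inner_diff_right)
    moreover have "(m \<bullet> z) * (n \<bullet> (p - A)) \<le> 0" using mz np by (simp add: mult_nonneg_nonpos)
    moreover have "(m \<bullet> (p - A)) * (n \<bullet> z) > 0" using mp z by (rule mult_neg_neg)
    ultimately show False by simp
  qed
  then obtain e where e: "e > 0" "A + e *\<^sub>R z \<in> interior D" by blast
  have "A + t *\<^sub>R z \<in> interior D" if "0 < t" "t < e" for t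
  proof -
    have "A - (t / e) *\<^sub>R (A - (A + e *\<^sub>R z)) \<in> interior D"
      using that e by (intro mem_interior_convex_shrink cv AD) auto
    then show ?thesis using e by simp
  qed
  then show ?thesis using e by blast
qed

text \<open>The quotient bounding \<alpha> is the first-order rate at which the boundary recedes
  along the turned ray; any larger rate leaves room for an interior point just before the boundary.
  A lower bound on \<open>s\<close> suffices, since the aim is to produce long chords.\<close>

lemma frontier_point_on_turned_ray:
  fixes D :: "'a::euclidean_space set"
  assumes sm: "smooth_convex D" and AD: "A \<in> D" and Af: "A \<in> frontier D" and p: "p \<in> interior D"
    and n: "n \<noteq> 0" and Dn: "D \<subseteq> {x. n \<bullet> x \<le> n \<bullet> A}"
    and U: "open U" "A \<in> U" and \<alpha>: "\<alpha> > (n \<bullet> w) / (n \<bullet> (A - p))"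
  shows "\<forall>\<^sub>F \<tau> in at_right 0. \<exists>s. s > 0 \<and> s \<ge> 1 - \<tau> * \<alpha> \<and>
           p + s *\<^sub>R ((A - p) + \<tau> *\<^sub>R w) \<in> frontier D \<inter> U"
proof -
  define v where "v = A - p"
  have A: "A = p + v" by (simp add: v_def)
  have nv: "n \<bullet> v > 0"
    using inner_less_of_mem_interior[OF p n Dn] by (simp add: v_def inner_diff_right)
  define \<kappa> where "\<kappa> = (n \<bullet> w) / (n \<bullet> v)"
  have nw: "n \<bullet> w = \<kappa> * (n \<bullet> v)" using nv by (simp add: \<kappa>_def)
  have "\<alpha> > \<kappa>" using \<alpha> by (simp add: \<kappa>_def v_def)
  then have "n \<bullet> (w - \<alpha> *\<^sub>R v) < 0" using nv by (simp add: inner_diff_right nw)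
  then obtain e where e: "e > 0" "\<And>t. 0 < t \<Longrightarrow> t < e \<Longrightarrow> A + t *\<^sub>R (w - \<alpha> *\<^sub>R v) \<in> interior D"
    using smooth_convex_inward_direction[OF sm AD Af p n Dn] by blast
  \<comment> \<open>A convex neighbourhood is wanted: a segment lies in it as soon as its end-points
    do.\<close>
  obtain \<epsilon> where \<epsilon>: "\<epsilon> > 0" "ball A \<epsilon> \<subseteq> U" using U open_contains_ball by blast
  \<comment> \<open>At scale \<open>lo\<close> the turned ray meets the ray from \<open>A\<close> in
    the inward direction \<open>w - \<alpha> *\<^sub>R v\<close>. In \<open>hi\<close>, the fraction
    is the scale at which the turned ray crosses the supporting hyperplane at \<open>A\<close>, and
    the extra \<tau> pushes the point strictly beyond it.\<close>
  define lo where "lo = (\<lambda>\<tau>::real. 1 / (1 + \<tau> * \<alpha>))"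
  define hi where "hi = (\<lambda>\<tau>::real. 1 / (1 + \<tau> * \<kappa>) + \<tau>)"
  define d where "d = (\<lambda>\<tau>::real. v + \<tau> *\<^sub>R w)"
  have tlo: "(lo \<longlongrightarrow> 1) (at_right 0)" unfolding lo_def by (rule tendsto_eq_intros | simp)+
  have thi: "(hi \<longlongrightarrow> 1) (at_right 0)" unfolding hi_def by (rule tendsto_eq_intros | simp)+
  have td: "(d \<longlongrightarrow> v) (at_right 0)" unfolding d_def by (rule tendsto_eq_intros | simp)+
  have "((\<lambda>\<tau>. p + lo \<tau> *\<^sub>R d \<tau>) \<longlongrightarrow> A) (at_right 0)" "((\<lambda>\<tau>. p + hi \<tau> *\<^sub>R d \<tau>) \<longlongrightarrow> A) (at_right 0)"
    unfolding A by (auto intro!: tendsto_eq_intros tlo thi td)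
  then have ev1: "\<forall>\<^sub>F \<tau> in at_right 0. p + lo \<tau> *\<^sub>R d \<tau> \<in> ball A \<epsilon>"
      "\<forall>\<^sub>F \<tau> in at_right 0. p + hi \<tau> *\<^sub>R d \<tau> \<in> ball A \<epsilon>"
    using \<epsilon>(1) by (simp_all only: topological_tendstoD open_ball centre_in_ball)
  have "((\<lambda>\<tau>. lo \<tau> * \<tau>) \<longlongrightarrow> 0) (at_right 0)" by (rule tendsto_eq_intros tlo | simp)+
  then have ev2: "\<forall>\<^sub>F \<tau> in at_right 0. lo \<tau> * \<tau> < e" using e(1) by (rule order_tendstoD)
  have "((\<lambda>\<tau>. 1 + \<tau> * \<alpha>) \<longlongrightarrow> 1) (at_right 0)" "((\<lambda>\<tau>. 1 + \<tau> * \<kappa>) \<longlongrightarrow> 1) (at_right 0)"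
    by (rule tendsto_eq_intros | simp)+
  then have ev3: "\<forall>\<^sub>F \<tau> in at_right 0. 1 + \<tau> * \<alpha> > 0" "\<forall>\<^sub>F \<tau> in at_right 0. 1 + \<tau> * \<kappa> > 0"
    by (auto intro: order_tendstoD)
  have ev4: "\<forall>\<^sub>F \<tau> in at_right 0. \<tau> > (0::real)" by (rule eventually_at_right_less)
  show ?thesis
    using ev1 ev2 ev3 ev4
  proof eventually_elim
    case (elim \<tau>)
    note pos = elim(4-6)
    have lo_pos: "lo \<tau> > 0" using pos by (simp add: lo_def)
    have "p + lo \<tau> *\<^sub>R d \<tau> = A + (lo \<tau> * \<tau>) *\<^sub>R (w - \<alpha> *\<^sub>R v)"
    proof -
      have "lo \<tau> = 1 - lo \<tau> * \<tau> * \<alpha>" using pos by (simp add: lo_def field_simps)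
      then have "lo \<tau> *\<^sub>R v = v - (lo \<tau> * \<tau> * \<alpha>) *\<^sub>R v" by (metis scaleR_left_diff_distrib scaleR_one)
      then show ?thesis by (simp add: d_def A scaleR_add_right scaleR_diff_right)
    qed
    then have lo_in: "p + lo \<tau> *\<^sub>R d \<tau> \<in> interior D"
      using e(2)[of "lo \<tau> * \<tau>"] elim lo_pos by simp
    have nd: "n \<bullet> d \<tau> = (1 + \<tau> * \<kappa>) * (n \<bullet> v)"
      by (simp add: d_def inner_add_right nw algebra_simps)
    have hi_gt: "hi \<tau> * (1 + \<tau> * \<kappa>) > 1"
      using pos by (simp add: hi_def distrib_right)
    have hi_out: "p + h *\<^sub>R d \<tau> \<notin> D" if "h \<ge> hi \<tau>" for h
    proof -
      have "h * (1 + \<tau> * \<kappa>) > 1"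
        using that pos hi_gt by (smt (verit) mult_right_mono)
      then have "n \<bullet> (h *\<^sub>R d \<tau>) > n \<bullet> v" using nv by (simp add: nd mult.assoc[symmetric])
      then show ?thesis using Dn by (auto simp: A inner_add_right)
    qed
    have lohi: "lo \<tau> \<le> hi \<tau>"
      using hi_out[of "lo \<tau>"] lo_in interior_subset by force
    let ?S = "closed_segment (p + lo \<tau> *\<^sub>R d \<tau>) (p + hi \<tau> *\<^sub>R d \<tau>)"
    have "?S \<inter> D \<noteq> {}" using lo_in interior_subset by fastforce
    moreover have "?S - D \<noteq> {}" using hi_out[of "hi \<tau>"] by fastforce
    ultimately obtain q where q: "q \<in> ?S" "q \<in> frontier D"
      using connected_Int_frontier[of ?S D] by auto
    have "?S \<subseteq> ball A \<epsilon>" using elim by (intro closed_segment_subset) auto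
    then have qU: "q \<in> U" using q \<epsilon> by auto
    obtain u where u: "0 \<le> u" "u \<le> 1"
        "q = (1 - u) *\<^sub>R (p + lo \<tau> *\<^sub>R d \<tau>) + u *\<^sub>R (p + hi \<tau> *\<^sub>R d \<tau>)"
      using q(1) by (auto simp: in_segment)
    define s where "s = (1 - u) * lo \<tau> + u * hi \<tau>"
    have qs: "q = p + s *\<^sub>R d \<tau>" by (simp add: u(3) s_def algebra_simps)
    have "s = lo \<tau> + u * (hi \<tau> - lo \<tau>)" by (simp add: s_def algebra_simps)
    then have "s \<ge> lo \<tau>" using u lohi by simp
    moreover have "lo \<tau> \<ge> 1 - \<tau> * \<alpha>"
    proof -
      \<comment> \<open>The reciprocal is traded for its tangent line, so that the bound on
        \<open>s\<close> is linear in \<tau>.\<close>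
      have "(1 - \<tau> * \<alpha>) * (1 + \<tau> * \<alpha>) = 1 - (\<tau> * \<alpha>)\<^sup>2"
        by (simp add: power2_eq_square algebra_simps)
      then have "(1 - \<tau> * \<alpha>) * (1 + \<tau> * \<alpha>) \<le> 1" by simp
      then show ?thesis using pos by (simp add: lo_def pos_le_divide_eq)
    qed
    ultimately show ?case
      using q(2) qU qs lo_pos unfolding d_def v_def by (intro exI[of _ s]) auto
  qed
qed

section \<open>Variation of the chord\<close>

text \<open>If the sum were negative, turning the chord towards \<open>w\<close> would lengthen it
  to first order. Only one sign is obtained because \<tau> is positive; the other comes from
  replacing \<open>w\<close> by \<open>- w\<close>.\<close>

lemma local_maximizer_first_order:
  fixes D :: "'a::euclidean_space set"
  assumes cl: "closed D" and sm: "smooth_convex D" and p: "p \<in> interior D"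
    and lm: "local_maximizer D p A B"
    and n1: "n1 \<noteq> 0" "D \<subseteq> {x. n1 \<bullet> x \<le> n1 \<bullet> A}" and n2: "n2 \<noteq> 0" "D \<subseteq> {x. n2 \<bullet> x \<le> n2 \<bullet> B}"
    and v: "v = A - p" "B - p = - (k *\<^sub>R v)" and k: "k > 0" and w: "v \<bullet> w = 0"
  shows "(n1 \<bullet> w) / (n1 \<bullet> v) + k * ((n2 \<bullet> w) / (n2 \<bullet> v)) \<ge> 0"
proof (rule ccontr)
  define c1 where "c1 = (n1 \<bullet> w) / (n1 \<bullet> v)"
  define c2 where "c2 = (n2 \<bullet> w) / (n2 \<bullet> v)"
  assume "\<not> ?thesis"
  then have neg: "c1 + k * c2 < 0" by (simp add: c1_def c2_def)
  \<comment> \<open>Raising both rates by \<delta> costs \<open>(1 + k) * \<delta>\<close>, which is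
    half of the available gap, so the combined rate stays negative.\<close>
  define \<delta> where "\<delta> = - (c1 + k * c2) / (2 * (1 + k))"
  have \<delta>: "\<delta> > 0" using neg k by (simp add: \<delta>_def zero_less_divide_iff)
  have "(1 + k) * \<delta> = - (c1 + k * c2) / 2" using k by (simp add: \<delta>_def field_simps)
  then have sum: "(c1 + \<delta>) + k * (c2 + \<delta>) < 0" using neg by (simp add: algebra_simps)
  obtain U V where UV: "A \<in> frontier D" "B \<in> frontier D" "open U" "A \<in> U" "open V" "B \<in> V"
      "\<And>A' B'. A' \<in> frontier D \<inter> U \<Longrightarrow> B' \<in> frontier D \<inter> V \<Longrightarrow>
         p \<in> closed_segment A' B' \<Longrightarrow> dist A' B' \<le> dist A B"
    using lm unfolding local_maximizer_def by blast
  have AB: "A \<in> D" "B \<in> D" using UV cl frontier_subset_closed by blast+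
  have ev: "\<forall>\<^sub>F \<tau> in at_right 0. \<exists>s. s > 0 \<and> s \<ge> 1 - \<tau> * (c1 + \<delta>) \<and>
           p + s *\<^sub>R ((A - p) + \<tau> *\<^sub>R w) \<in> frontier D \<inter> U"
    using \<delta> by (intro frontier_point_on_turned_ray[OF sm AB(1) UV(1) p n1 UV(3,4)])
      (simp add: c1_def v)
  \<comment> \<open>Turning \<open>B - p\<close> by a multiple of \<open>- (k *\<^sub>R w)\<close>
    keeps it opposite to \<open>v + \<tau> *\<^sub>R w\<close>; the factor \<open>- k\<close>
    cancels in the quotient.\<close>
  have "(n2 \<bullet> (- (k *\<^sub>R w))) / (n2 \<bullet> (B - p)) = c2"
    using k by (simp add: c2_def v(2))
  then have ev': "\<forall>\<^sub>F \<tau> in at_right 0. \<exists>s. s > 0 \<and> s \<ge> 1 - \<tau> * (c2 + \<delta>) \<and>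
           p + s *\<^sub>R ((B - p) + \<tau> *\<^sub>R (- (k *\<^sub>R w))) \<in> frontier D \<inter> V"
    using \<delta> by (intro frontier_point_on_turned_ray[OF sm AB(2) UV(2) p n2 UV(5,6)]) simp
  have "\<forall>\<^sub>F \<tau> in at_right 0. \<tau> > (0::real)" by (rule eventually_at_right_less)
  \<comment> \<open>The filter \<open>at_right 0\<close> is nontrivial, so an eventual contradiction
    is a contradiction.\<close>
  with ev ev' have "\<forall>\<^sub>F \<tau> in at_right (0::real). False"
  proof eventually_elim
    case (elim \<tau>)
    define d where "d = v + \<tau> *\<^sub>R w"
    obtain s where s: "s > 0" "s \<ge> 1 - \<tau> * (c1 + \<delta>)" "p + s *\<^sub>R d \<in> frontier D \<inter> U"
      using elim(1) unfolding d_def v(1) by blast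
    obtain s' where s': "s' > 0" "s' \<ge> 1 - \<tau> * (c2 + \<delta>)"
        "p + s' *\<^sub>R ((B - p) + \<tau> *\<^sub>R (- (k *\<^sub>R w))) \<in> frontier D \<inter> V"
      using elim(2) by blast
    have "p + s' *\<^sub>R ((B - p) + \<tau> *\<^sub>R (- (k *\<^sub>R w))) = p - (k * s') *\<^sub>R d"
      unfolding v(2) d_def by (simp add: algebra_simps)
    then have B': "p - (k * s') *\<^sub>R d \<in> frontier D \<inter> V" using s'(3) by simp
    define t where "t = k * s'"
    have t: "t > 0" using k s' by (simp add: t_def)
    have "p \<in> closed_segment (p + s *\<^sub>R d) (p - t *\<^sub>R d)"
    proof -
      have "p = (1 - s / (s + t)) *\<^sub>R (p + s *\<^sub>R d) + (s / (s + t)) *\<^sub>R (p - t *\<^sub>R d)"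
      proof -
        have "(1 - s / (s + t)) * s - (s / (s + t)) * t = 0"
          using s(1) t by (simp add: field_simps)
        moreover have "(1 - s / (s + t)) *\<^sub>R (p + s *\<^sub>R d) + (s / (s + t)) *\<^sub>R (p - t *\<^sub>R d)
            = p + ((1 - s / (s + t)) * s - (s / (s + t)) * t) *\<^sub>R d"
          by (simp add: algebra_simps)
        ultimately show ?thesis by simp
      qed
      moreover have "0 \<le> s / (s + t)" "s / (s + t) \<le> 1" using s(1) t by auto
      ultimately show ?thesis unfolding in_segment by blast
    qed
    then have le: "dist (p + s *\<^sub>R d) (p - t *\<^sub>R d) \<le> dist A B"
      using UV(7) s(3) B' by (simp add: t_def)
    have "(p + s *\<^sub>R d) - (p - t *\<^sub>R d) = (s + t) *\<^sub>R d" by (simp add: algebra_simps)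
    then have d1: "dist (p + s *\<^sub>R d) (p - t *\<^sub>R d) = (s + t) * norm d"
      using s(1) t by (simp only: dist_norm norm_scaleR)
    have "A - B = (A - p) - (B - p)" by simp
    then have "A - B = (1 + k) *\<^sub>R v" unfolding v(2) v(1)[symmetric] by (simp add: scaleR_add_left)
    then have d2: "dist A B = (1 + k) * norm v"
      using k by (simp only: dist_norm norm_scaleR)
    \<comment> \<open>Since \<open>w\<close> is orthogonal to \<open>v\<close>, the turned direction
      vector is no shorter than \<open>v\<close>, and it remains to compare the scales.\<close>
    have "(norm d)\<^sup>2 = (norm v)\<^sup>2 + (norm (\<tau> *\<^sub>R w))\<^sup>2"
      unfolding d_def using w by (intro norm_add_Pythagorean) (simp add: orthogonal_def)
    then have "(norm v)\<^sup>2 \<le> (norm d)\<^sup>2" by simp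
    then have nd: "norm v \<le> norm d" by (rule power2_le_imp_le) simp
    have "v \<noteq> 0" using v(1) p UV(1) by (auto simp: frontier_def)
    have "s + t > 1 + k"
    proof -
      have "t \<ge> k * (1 - \<tau> * (c2 + \<delta>))" using s'(2) k by (simp add: t_def)
      then have "s + t \<ge> 1 + k - \<tau> * ((c1 + \<delta>) + k * (c2 + \<delta>))"
        using s(2) by (simp add: algebra_simps)
      moreover have "\<tau> * ((c1 + \<delta>) + k * (c2 + \<delta>)) < 0" using elim(3) sum by (simp add: mult_pos_neg)
      ultimately show ?thesis by simp
    qed
    then have "(1 + k) * norm v < (s + t) * norm v" using \<open>v \<noteq> 0\<close> by simp
    also have "\<dots> \<le> (s + t) * norm d" using nd s(1) t by simp
    finally show False using le d1 d2 by simp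
  qed
  then show False by simp
qed

section \<open>Intersection of the normal lines\<close>

theorem theorem22:
  fixes D H1 H2 :: "(real ^ 'n) set" and p A B :: "real ^ 'n"
  assumes "CARD('n) \<ge> 2"
    and "closed D"
    and "smooth_convex D"
    and "p \<in> interior D"
    and "local_maximizer D p A B"
    and "supporting_hyperplane D A H1"
    and "supporting_hyperplane D B H2"
  shows "\<exists>x. x \<in> normal_line H1 A \<and> x \<in> normal_line H2 B \<and> x \<in> orthogonal_hyperplane p A B"
proof -
  obtain n1 where n1: "n1 \<noteq> 0" "H1 = {x. n1 \<bullet> x = n1 \<bullet> A}" "D \<subseteq> {x. n1 \<bullet> x \<le> n1 \<bullet> A}"
    using assms(6) by (rule supporting_hyperplane_normalE)
  obtain n2 where n2: "n2 \<noteq> 0" "H2 = {x. n2 \<bullet> x = n2 \<bullet> B}" "D \<subseteq> {x. n2 \<bullet> x \<le> n2 \<bullet> B}"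
    using assms(7) by (rule supporting_hyperplane_normalE)
  have "A \<noteq> p" "B \<noteq> p" "p \<in> closed_segment A B"
    using assms(4,5) by (auto simp: local_maximizer_def frontier_def)
  then obtain u where u: "0 \<le> u" "u \<le> 1" "p = (1 - u) *\<^sub>R A + u *\<^sub>R B" "u \<noteq> 0" "u \<noteq> 1"
    by (force simp: in_segment)
  define v where "v = A - p"
  \<comment> \<open>The ratio of the distances from \<open>p\<close> to \<open>B\<close> and to
    \<open>A\<close>.\<close>
  define k where "k = (1 - u) / u"
  have k: "k > 0" using u by (simp add: k_def)
  have Bv: "B - p = - (k *\<^sub>R v)"
  proof -
    have "u *\<^sub>R (B - p) = - ((1 - u) *\<^sub>R v)"
      unfolding v_def using u(3) by (simp add: algebra_simps)
    then have "(1 / u) *\<^sub>R (u *\<^sub>R (B - p)) = (1 / u) *\<^sub>R (- ((1 - u) *\<^sub>R v))" by simp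
    then show ?thesis using u by (simp add: k_def)
  qed
  have v0: "v \<noteq> 0" using \<open>A \<noteq> p\<close> by (simp add: v_def)
  have nv1: "n1 \<bullet> v > 0"
    using inner_less_of_mem_interior[OF assms(4) n1(1,3)] by (simp add: v_def inner_diff_right)
  have "n2 \<bullet> (B - p) > 0"
    using inner_less_of_mem_interior[OF assms(4) n2(1,3)] by (simp add: inner_diff_right)
  then have nv2: "n2 \<bullet> v < 0" using k unfolding Bv by (simp add: mult_less_0_iff)
  \<comment> \<open>The vector representing the first-order expression as a linear functional of
    \<open>w\<close>.\<close>
  define q where "q = (1 / (n1 \<bullet> v)) *\<^sub>R n1 + (k / (n2 \<bullet> v)) *\<^sub>R n2"
  have first_order: "q \<bullet> w \<ge> 0" if "v \<bullet> w = 0" for w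
    using local_maximizer_first_order[OF assms(2-5) n1(1,3) n2(1,3) v_def Bv k that]
    by (simp add: q_def inner_add_left)
  have qv: "q \<bullet> v = 1 + k" using nv1 nv2 by (simp add: q_def inner_add_left)
  \<comment> \<open>Up to scaling, this is the component of \<open>q\<close> orthogonal to
    \<open>v\<close>. Testing with \<open>w\<close> and \<open>- w\<close> makes it orthogonal to
    \<open>q\<close> as well, hence to itself, so \<open>q\<close> is parallel to
    \<open>v\<close>.\<close>
  define w where "w = (1 + k) *\<^sub>R v - (v \<bullet> v) *\<^sub>R q"
  have vw: "v \<bullet> w = 0" using qv by (simp add: w_def inner_diff_right inner_commute)
  have "q \<bullet> w = 0" using first_order[OF vw] first_order[of "- w"] vw by simp
  then have "((1 + k) *\<^sub>R v - (v \<bullet> v) *\<^sub>R q) \<bullet> w = 0" using vw by (simp add: inner_diff_left)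
  then have "w \<bullet> w = 0" by (simp only: w_def[symmetric])
  then have w0: "(v \<bullet> v) *\<^sub>R q = (1 + k) *\<^sub>R v" by (simp add: w_def)
  \<comment> \<open>The coefficient is forced by \<open>(x - p) \<bullet> v = 0\<close>: this is
    where the normal line at \<open>A\<close> meets the hyperplane through \<open>p\<close>. The
    parallelism of \<open>q\<close> and \<open>v\<close> puts the same point on the normal line at
    \<open>B\<close>.\<close>
  define x where "x = A - ((v \<bullet> v) / (n1 \<bullet> v)) *\<^sub>R n1"
  have "(v \<bullet> v) *\<^sub>R q = ((v \<bullet> v) / (n1 \<bullet> v)) *\<^sub>R n1 + (k * (v \<bullet> v) / (n2 \<bullet> v)) *\<^sub>R n2"
    by (simp add: q_def scaleR_add_right mult.commute)
  then have "((v \<bullet> v) / (n1 \<bullet> v)) *\<^sub>R n1 = (1 + k) *\<^sub>R v - (k * (v \<bullet> v) / (n2 \<bullet> v)) *\<^sub>R n2"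
    using w0 by (simp add: algebra_simps)
  moreover have BA: "A - B = (1 + k) *\<^sub>R v" using Bv by (simp add: v_def algebra_simps)
  ultimately have xB: "x - B = (k * (v \<bullet> v) / (n2 \<bullet> v)) *\<^sub>R n2"
    unfolding x_def by (simp add: algebra_simps)
  have xA: "x - A = (- (v \<bullet> v) / (n1 \<bullet> v)) *\<^sub>R n1" by (simp add: x_def)
  have "x \<in> normal_line H1 A" "x \<in> normal_line H2 B"
    unfolding normal_line_def n1(2) n2(2) by (auto simp: orthogonal_def xA xB inner_diff_right)
  moreover have "x \<in> orthogonal_hyperplane p A B"
  proof -
    have "x - p = v - ((v \<bullet> v) / (n1 \<bullet> v)) *\<^sub>R n1" by (simp add: x_def v_def)
    then have "(x - p) \<bullet> v = 0" using nv1 by (simp add: inner_diff_left)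
    moreover have "B - A = - ((1 + k) *\<^sub>R v)" using BA by (metis minus_diff_eq)
    ultimately show ?thesis
      by (simp add: orthogonal_hyperplane_def orthogonal_def)
  qed
  ultimately show ?thesis by blast
qed

end
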